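(* Let $M$ be a partition matroid on a ground set $E=\{e_1,\ldots,e_n\}$ and, for $i\in\{0,\ldots,n\}$, let $E_i=\{e_1,\ldots,e_i\}$. Then the number of minors of $M$ on $E\setminus E_i$ is at most $2^{\lambda_M(E_i)}$.
   Context: A partition matroid is a direct sum of uniform matroids, where a uniform matroid of rank $r$ has as independent sets exactly the subsets of its ground set of size at most $r$, and the direct sum $M_1\oplus M_2$ of matroids on disjoint ground sets has independent sets $I_1\cup I_2$ with $I_j$ independent in $M_j$. $r_M$ is the rank function, $r(M)=r_M(E)$, and $\lambda_M(X)=r_M(X)+r_M(E\setminus X)-r(M)$ is the connectivity function. For disjoint $X,Y\subseteq E$, $M\setminus X/Y$ is the matroid obtained by deleting $X$ and contracting $Y$. The minors of $M$ on $E\setminus E_i$ are the matroids $M\setminus(E_i\setminus Y)/Y$ for $Y\subseteq E_i$; their number is the number of distinct such matroids. *)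

theory Defs
  imports Complex_Main
begin

text \<open>
  Matroids are given by a ground set and the family of independent sets, so equality of matroids
  on the same ground set is equality of the families of independent sets.
\<close>

datatype 'a matroid = Matroid (ground: "'a set") (indeps: "'a set set")

definition is_matroid :: "'a matroid \<Rightarrow> bool" where
  "is_matroid M \<longleftrightarrow>
     finite (ground M) \<and> indeps M \<subseteq> Pow (ground M) \<and> {} \<in> indeps M \<and>
     (\<forall>J\<in>indeps M. \<forall>I. I \<subseteq> J \<longrightarrow> I \<in> indeps M) \<and>
     (\<forall>I\<in>indeps M. \<forall>J\<in>indeps M. card I < card J \<longrightarrow> (\<exists>x\<in>J - I. insert x I \<in> indeps M))"

definition rank_of :: "'a matroid \<Rightarrow> 'a set \<Rightarrow> nat" where
  "rank_of M X = Max (card ` {I \<in> indeps M. I \<subseteq> X})"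

definition connectivity :: "'a matroid \<Rightarrow> 'a set \<Rightarrow> int" where
  "connectivity M X =
     int (rank_of M X) + int (rank_of M (ground M - X)) - int (rank_of M (ground M))"

definition is_basis_of :: "'a matroid \<Rightarrow> 'a set \<Rightarrow> 'a set \<Rightarrow> bool" where
  "is_basis_of M X B \<longleftrightarrow>
     B \<in> indeps M \<and> B \<subseteq> X \<and> (\<forall>I\<in>indeps M. B \<subseteq> I \<longrightarrow> I \<subseteq> X \<longrightarrow> I = B)"

definition delete :: "'a matroid \<Rightarrow> 'a set \<Rightarrow> 'a matroid" where
  "delete M X = Matroid (ground M - X) {I \<in> indeps M. I \<inter> X = {}}"

text \<open>
  A set is independent in the contraction by \<open>Y\<close> iff its union with a basis of \<open>Y\<close> is
  independent; in a matroid this does not depend on the chosen basis.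
\<close>

definition contract :: "'a matroid \<Rightarrow> 'a set \<Rightarrow> 'a matroid" where
  "contract M Y =
     Matroid (ground M - Y)
       {I. I \<subseteq> ground M - Y \<and> (\<exists>B. is_basis_of M Y B \<and> I \<union> B \<in> indeps M)}"

text \<open>The minors of \<open>M\<close> on the complement of \<open>S\<close>.\<close>

definition minors_off :: "'a matroid \<Rightarrow> 'a set \<Rightarrow> 'a matroid set" where
  "minors_off M S = {contract (delete M (S - Y)) Y | Y. Y \<subseteq> S}"

definition uniform_matroid :: "nat \<Rightarrow> 'a set \<Rightarrow> 'a matroid" where
  "uniform_matroid r S = Matroid S {I. I \<subseteq> S \<and> card I \<le> r}"

definition direct_sum :: "'a matroid \<Rightarrow> 'a matroid \<Rightarrow> 'a matroid" where
  "direct_sum M1 M2 =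
     Matroid (ground M1 \<union> ground M2) {I1 \<union> I2 | I1 I2. I1 \<in> indeps M1 \<and> I2 \<in> indeps M2}"

text \<open>The condition \<open>r \<le> card S\<close> makes \<open>r\<close> the rank of the uniform matroid.\<close>

inductive partition_matroid :: "'a matroid \<Rightarrow> bool" where
  uniform: "finite S \<Longrightarrow> r \<le> card S \<Longrightarrow> partition_matroid (uniform_matroid r S)"
| sum: "partition_matroid M1 \<Longrightarrow> partition_matroid M2 \<Longrightarrow> ground M1 \<inter> ground M2 = {} \<Longrightarrow>
        partition_matroid (direct_sum M1 M2)"

lemma is_matroidI:
  assumes "finite (ground M)" "indeps M \<subseteq> Pow (ground M)" "{} \<in> indeps M"
    and "\<And>I J. J \<in> indeps M \<Longrightarrow> I \<subseteq> J \<Longrightarrow> I \<in> indeps M"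
    and "\<And>I J. I \<in> indeps M \<Longrightarrow> J \<in> indeps M \<Longrightarrow> card I < card J \<Longrightarrow>
           \<exists>x\<in>J - I. insert x I \<in> indeps M"
  shows "is_matroid M"
  unfolding is_matroid_def by (intro conjI ballI allI impI) (fact assms | rule assms; assumption)+

lemma is_matroidD:
  assumes "is_matroid M"
  shows "finite (ground M)" "indeps M \<subseteq> Pow (ground M)" "{} \<in> indeps M"
    and "\<And>I J. J \<in> indeps M \<Longrightarrow> I \<subseteq> J \<Longrightarrow> I \<in> indeps M"
    and "\<And>I J. I \<in> indeps M \<Longrightarrow> J \<in> indeps M \<Longrightarrow> card I < card J \<Longrightarrow>
           \<exists>x\<in>J - I. insert x I \<in> indeps M"
    and "\<And>I. I \<in> indeps M \<Longrightarrow> finite I"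
  using assms unfolding is_matroid_def by (simp, simp, simp, meson, meson, meson PowD finite_subset subsetD)

lemma is_matroid_uniform:
  assumes "finite S"
  shows "is_matroid (uniform_matroid r S)"
proof (rule is_matroidI)
  fix I J assume "J \<in> indeps (uniform_matroid r S)" "I \<subseteq> J"
  moreover from this have "card I \<le> card J"
    using assms by (auto simp: uniform_matroid_def intro!: card_mono intro: finite_subset)
  ultimately show "I \<in> indeps (uniform_matroid r S)"
    by (auto simp: uniform_matroid_def)
next
  fix I J assume IJ: "I \<in> indeps (uniform_matroid r S)" "J \<in> indeps (uniform_matroid r S)"
    "card I < card J"
  have fin: "finite I" using IJ assms by (auto simp: uniform_matroid_def intro: finite_subset)
  have "\<not> J \<subseteq> I" using IJ(3) fin card_mono[of I J] by auto
  then obtain x where "x \<in> J - I" by blast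
  then show "\<exists>x\<in>J - I. insert x I \<in> indeps (uniform_matroid r S)"
    using IJ fin by (intro bexI[of _ x]) (auto simp: uniform_matroid_def)
qed (use assms in \<open>auto simp: uniform_matroid_def\<close>)

lemma direct_sum_indepsI:
  "I = I1 \<union> I2 \<Longrightarrow> I1 \<in> indeps M1 \<Longrightarrow> I2 \<in> indeps M2 \<Longrightarrow> I \<in> indeps (direct_sum M1 M2)"
  unfolding direct_sum_def by auto

lemma is_matroid_direct_sum:
  assumes M1: "is_matroid M1" and M2: "is_matroid M2" and disj: "ground M1 \<inter> ground M2 = {}"
  shows "is_matroid (direct_sum M1 M2)"
proof (rule is_matroidI)
  note D1 = is_matroidD[OF M1] and D2 = is_matroidD[OF M2]
  show "finite (ground (direct_sum M1 M2))"
    using D1(1) D2(1) by (simp add: direct_sum_def)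
  show "indeps (direct_sum M1 M2) \<subseteq> Pow (ground (direct_sum M1 M2))"
    using D1(2) D2(2) by (auto simp: direct_sum_def)
  show "{} \<in> indeps (direct_sum M1 M2)"
    using D1(3) D2(3) by (auto simp: direct_sum_def)
  show "I \<in> indeps (direct_sum M1 M2)"
    if J: "J \<in> indeps (direct_sum M1 M2)" and sub: "I \<subseteq> J" for I J
  proof -
    obtain J1 J2 where "J = J1 \<union> J2" "J1 \<in> indeps M1" "J2 \<in> indeps M2"
      using J by (auto simp: direct_sum_def)
    then have "I = (I \<inter> J1) \<union> (I \<inter> J2)" "I \<inter> J1 \<in> indeps M1" "I \<inter> J2 \<in> indeps M2"
      using sub D1(4)[of J1 "I \<inter> J1"] D2(4)[of J2 "I \<inter> J2"] by auto
    then show ?thesis by (rule direct_sum_indepsI)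
  qed
  show "\<exists>x\<in>J - I. insert x I \<in> indeps (direct_sum M1 M2)"
    if I: "I \<in> indeps (direct_sum M1 M2)" and J: "J \<in> indeps (direct_sum M1 M2)"
      and less: "card I < card J" for I J
  proof -
    obtain I1 I2 where I12: "I = I1 \<union> I2" "I1 \<in> indeps M1" "I2 \<in> indeps M2"
      using I by (auto simp: direct_sum_def)
    obtain J1 J2 where J12: "J = J1 \<union> J2" "J1 \<in> indeps M1" "J2 \<in> indeps M2"
      using J by (auto simp: direct_sum_def)
    have sub: "I1 \<subseteq> ground M1" "I2 \<subseteq> ground M2" "J1 \<subseteq> ground M1" "J2 \<subseteq> ground M2"
      using I12 J12 D1(2) D2(2) by auto
    have "card I = card I1 + card I2"
      unfolding I12(1) using sub disj D1(6)[OF I12(2)] D2(6)[OF I12(3)] by (intro card_Un_disjoint) auto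
    moreover have "card J = card J1 + card J2"
      unfolding J12(1) using sub disj D1(6)[OF J12(2)] D2(6)[OF J12(3)] by (intro card_Un_disjoint) auto
    ultimately consider "card I1 < card J1" | "card I2 < card J2"
      using less by linarith
    then show ?thesis
    proof cases
      case 1
      then obtain x where x: "x \<in> J1 - I1" "insert x I1 \<in> indeps M1"
        using D1(5) I12 J12 by blast
      have "insert x I = insert x I1 \<union> I2" using I12 by simp
      then have "insert x I \<in> indeps (direct_sum M1 M2)"
        using x(2) I12(3) by (rule direct_sum_indepsI)
      moreover have "x \<in> J - I" using x sub disj I12(1) J12(1) by auto
      ultimately show ?thesis by blast
    next
      case 2
      then obtain x where x: "x \<in> J2 - I2" "insert x I2 \<in> indeps M2"
        using D2(5) I12 J12 by blast
      have "insert x I = I1 \<union> insert x I2" using I12 by simp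
      then have "insert x I \<in> indeps (direct_sum M1 M2)"
        using I12(2) x(2) by (rule direct_sum_indepsI)
      moreover have "x \<in> J - I" using x sub disj I12(1) J12(1) by auto
      ultimately show ?thesis by blast
    qed
  qed
qed

lemma partition_matroid_is_matroid: "partition_matroid M \<Longrightarrow> is_matroid M"
  by (induction rule: partition_matroid.induct)
    (auto intro: is_matroid_uniform is_matroid_direct_sum)

lemma is_matroid_delete:
  assumes "is_matroid M"
  shows "is_matroid (delete M X)"
proof (rule is_matroidI)
  note D = is_matroidD[OF assms]
  show "\<exists>x\<in>J - I. insert x I \<in> indeps (delete M X)"
    if "I \<in> indeps (delete M X)" "J \<in> indeps (delete M X)" "card I < card J" for I J
    using D(5)[of I J] that by (auto simp: delete_def)
  show "I \<in> indeps (delete M X)" if "J \<in> indeps (delete M X)" "I \<subseteq> J" for I J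
    using D(4)[of J I] that by (auto simp: delete_def)
qed (use is_matroidD(1-3)[OF assms] in \<open>auto simp: delete_def\<close>)

lemma is_basis_of_exists:
  assumes "is_matroid M"
  shows "\<exists>B. is_basis_of M X B"
proof -
  note D = is_matroidD[OF assms]
  let ?A = "{I \<in> indeps M. I \<subseteq> X}"
  have "?A \<subseteq> Pow (ground M)" using D(2) by blast
  then have "finite ?A" by (rule finite_subset) (simp add: D(1))
  moreover have "?A \<noteq> {}" using D(3) by blast
  ultimately obtain B where "B \<in> ?A" "\<forall>I\<in>?A. B \<subseteq> I \<longrightarrow> B = I"
    by (rule finite_has_maximal[THEN bexE])
  then show ?thesis unfolding is_basis_of_def by blast
qed

lemma is_basis_of_card_le:
  assumes "is_matroid M" "is_basis_of M X B" "I \<in> indeps M" "I \<subseteq> X"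
  shows "card I \<le> card B"
proof (rule ccontr)
  assume "\<not> card I \<le> card B"
  then obtain x where "x \<in> I - B" "insert x B \<in> indeps M"
    using is_matroidD(5)[OF assms(1), of B I] assms by (auto simp: is_basis_of_def)
  then show False using assms(2,4) unfolding is_basis_of_def by blast
qed

lemma is_matroid_contract:
  assumes "is_matroid M"
  shows "is_matroid (contract M Y)"
proof (rule is_matroidI)
  note D = is_matroidD[OF assms]
  show "finite (ground (contract M Y))" using D(1) by (simp add: contract_def)
  show "indeps (contract M Y) \<subseteq> Pow (ground (contract M Y))" by (auto simp: contract_def)
  show "{} \<in> indeps (contract M Y)"
    using is_basis_of_exists[OF assms, of Y] by (auto simp: contract_def is_basis_of_def)
  show "I \<in> indeps (contract M Y)" if J: "J \<in> indeps (contract M Y)" and sub: "I \<subseteq> J" for I J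
  proof -
    obtain B where "J \<subseteq> ground M - Y" "is_basis_of M Y B" "J \<union> B \<in> indeps M"
      using J by (auto simp: contract_def)
    moreover from this have "I \<union> B \<in> indeps M" using D(4)[of "J \<union> B" "I \<union> B"] sub by auto
    ultimately show ?thesis using sub by (auto simp: contract_def)
  qed
  show "\<exists>x\<in>J - I. insert x I \<in> indeps (contract M Y)"
    if I: "I \<in> indeps (contract M Y)" and J: "J \<in> indeps (contract M Y)"
      and less: "card I < card J" for I J
  proof -
    obtain B where B: "I \<subseteq> ground M - Y" "is_basis_of M Y B" "I \<union> B \<in> indeps M"
      using I by (auto simp: contract_def)
    obtain C where C: "J \<subseteq> ground M - Y" "is_basis_of M Y C" "J \<union> C \<in> indeps M"
      using J by (auto simp: contract_def)
    have sub: "B \<subseteq> Y" "C \<subseteq> Y" "B \<in> indeps M" "C \<in> indeps M"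
      using B C by (auto simp: is_basis_of_def)
    have "card B = card C"
      using is_basis_of_card_le[OF assms] B(2) C(2) sub by (meson le_antisym)
    moreover have "card (I \<union> B) = card I + card B"
      using D(6)[OF B(3)] B(1) sub by (intro card_Un_disjoint) auto
    moreover have "card (J \<union> C) = card J + card C"
      using D(6)[OF C(3)] C(1) sub by (intro card_Un_disjoint) auto
    ultimately have "card (I \<union> B) < card (J \<union> C)" using less by simp
    then obtain x where x: "x \<in> (J \<union> C) - (I \<union> B)" "insert x (I \<union> B) \<in> indeps M"
      using D(5)[OF B(3) C(3)] by blast
    have "x \<notin> C"
    proof
      assume "x \<in> C"
      then have "insert x B \<subseteq> Y" using sub by auto
      moreover have "insert x B \<in> indeps M" using D(4)[OF x(2), of "insert x B"] by auto
      ultimately show False using B(2) x(1) unfolding is_basis_of_def by blast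
    qed
    then have "x \<in> J - I" using x(1) by auto
    moreover have "insert x I \<in> indeps (contract M Y)"
      using x(2) B(1,2) C(1) \<open>x \<in> J - I\<close> by (auto simp: contract_def)
    ultimately show ?thesis by blast
  qed
qed

lemma finite_minors_off: "finite S \<Longrightarrow> finite (minors_off M S)"
  unfolding minors_off_def by (simp add: setcompr_eq_image Pow_def[symmetric])

end

theory Submission
  imports Defs
begin

text \<open>
  Deletion and contraction commute with direct sums, so a minor of a sum is the sum of a minor of
  each summand, while the connectivity function is additive; the bound therefore passes to direct
  sums. For the uniform matroid of rank \<open>r\<close> on \<open>E\<close>, the minor obtained by contracting \<open>Y \<subseteq> S\<close> is
  again uniform and determined by its rank \<open>min |E - S| (r - |Y|)\<close>. As \<open>|Y|\<close> varies, this rank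
  takes at most \<open>\<lambda>(S) + 1 \<le> 2 ^ \<lambda>(S)\<close> values.
\<close>

section \<open>Bases and rank in a general matroid\<close>

text \<open>By exchange no independent subset of \<open>X\<close> is larger than \<open>B\<close>,
  so \<open>B\<close> attains the maximum; finiteness of the family makes \<open>Max\<close>
  meaningful.\<close>

lemma card_eq_rank_of:
  assumes M: "is_matroid M" and B: "is_basis_of M X B"
  shows "card B = rank_of M X"
proof -
  note D = is_matroidD[OF M]
  have "finite {I \<in> indeps M. I \<subseteq> X}"
    by (rule finite_subset[of _ "Pow (ground M)"]) (use D(1,2) in auto)
  then have "Max (card ` {I \<in> indeps M. I \<subseteq> X}) = card B"
    using B is_basis_of_card_le[OF M B]
    by (intro Max_eqI) (auto simp: is_basis_of_def)
  then show ?thesis by (simp add: rank_of_def)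
qed

text \<open>Lets a summand's rank be evaluated at sets that also contain elements of the other
  summand.\<close>

lemma rank_of_Int_ground:
  assumes "is_matroid M"
  shows "rank_of M (X \<inter> ground M) = rank_of M X"
proof -
  have "{I \<in> indeps M. I \<subseteq> X \<inter> ground M} = {I \<in> indeps M. I \<subseteq> X}"
    using is_matroidD(2)[OF assms] by auto
  then show ?thesis by (simp add: rank_of_def)
qed

section \<open>Minors and connectivity of uniform matroids\<close>

lemma ground_uniform_matroid [simp]: "ground (uniform_matroid r E) = E"
  and indeps_uniform_matroid [simp]: "indeps (uniform_matroid r E) = {I. I \<subseteq> E \<and> card I \<le> r}"
  by (simp_all add: uniform_matroid_def)

text \<open>The set \<open>X\<close> may leave \<open>E\<close>, so only \<open>X \<inter> E\<close>
  counts. A subset of \<open>X \<inter> E\<close> with exactly the claimed number of elements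
  attains the upper bound.\<close>

lemma rank_of_uniform_matroid:
  assumes "finite E"
  shows "rank_of (uniform_matroid r E) X = min r (card (X \<inter> E))"
proof -
  let ?A = "{I \<in> indeps (uniform_matroid r E). I \<subseteq> X}"
  have "?A \<subseteq> Pow E" by auto
  then have "finite ?A" by (rule finite_subset) (use assms in simp)
  obtain I where I: "I \<subseteq> X \<inter> E" "card I = min r (card (X \<inter> E))"
    by (rule obtain_subset_with_card_n[of "min r (card (X \<inter> E))" "X \<inter> E"]) simp_all
  have "Max (card ` ?A) = min r (card (X \<inter> E))"
  proof (rule Max_eqI)
    show "finite (card ` ?A)" using \<open>finite ?A\<close> by (rule finite_imageI)
    show "k \<le> min r (card (X \<inter> E))" if "k \<in> card ` ?A" for k
    proof -
      obtain J where J: "k = card J" "J \<subseteq> X \<inter> E" "card J \<le> r" using \<open>k \<in> card ` ?A\<close> by auto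
      have "card J \<le> card (X \<inter> E)" using J(2) assms by (intro card_mono) auto
      then show ?thesis using J by simp
    qed
    have "I \<in> ?A" using I by auto
    then show "min r (card (X \<inter> E)) \<in> card ` ?A" unfolding I(2)[symmetric] by (rule imageI)
  qed
  then show ?thesis by (simp add: rank_of_def)
qed

lemma delete_uniform_matroid: "delete (uniform_matroid r E) X = uniform_matroid r (E - X)"
  by (auto simp: delete_def uniform_matroid_def)

text \<open>All bases of \<open>Y\<close> have the same size and are disjoint from \<open>I\<close>,
  so independence of \<open>I \<union> B\<close> depends only on \<open>card I\<close>.\<close>

lemma contract_uniform_matroid:
  assumes E: "finite E"
  shows "contract (uniform_matroid r E) Y = uniform_matroid (r - card (Y \<inter> E)) (E - Y)"
proof -
  let ?U = "uniform_matroid r E"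
  have U: "is_matroid ?U" using E by (rule is_matroid_uniform)
  have indep_iff: "I \<union> B \<in> indeps ?U \<longleftrightarrow> card I \<le> r - card (Y \<inter> E)"
    if I: "I \<subseteq> E - Y" and B: "is_basis_of ?U Y B" for I B
  proof -
    have sub: "B \<subseteq> Y" "B \<subseteq> E" using B by (auto simp: is_basis_of_def)
    have "card (I \<union> B) = card I + card B"
      using I sub E by (intro card_Un_disjoint) (auto intro: finite_subset)
    moreover have "card B = min r (card (Y \<inter> E))"
      using card_eq_rank_of[OF U B] rank_of_uniform_matroid[OF E] by simp
    moreover have "I \<union> B \<subseteq> E" using I sub by auto
    \<comment> \<open>The truncated subtraction is right: if
      \<open>card (Y \<inter> E) \<ge> r\<close>, then \<open>B\<close> already has \<open>r\<close>
      elements and only the empty \<open>I\<close> remains.\<close>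
    ultimately show ?thesis by auto
  qed
  obtain B where "is_basis_of ?U Y B" using is_basis_of_exists[OF U] by blast
  then have "{I. I \<subseteq> E - Y \<and> (\<exists>B. is_basis_of ?U Y B \<and> I \<union> B \<in> indeps ?U)}
    = {I. I \<subseteq> E - Y \<and> card I \<le> r - card (Y \<inter> E)}"
    using indep_iff by blast
  then show ?thesis unfolding contract_def by (simp add: uniform_matroid_def)
qed

text \<open>Subsets of \<open>E\<close> never exceed \<open>card E\<close>, so larger ranks describe
  the same matroid. Capping the rank avoids counting a minor repeatedly.\<close>

lemma uniform_matroid_min_card:
  assumes "finite E"
  shows "uniform_matroid (min (card E) r) E = uniform_matroid r E"
  using card_mono[OF assms] by (auto simp: uniform_matroid_def)

lemma card_minors_off_uniform_matroid:
  assumes E: "finite E" and r: "r \<le> card E"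
  shows "real (card (minors_off (uniform_matroid r E) S))
    \<le> 2 powi connectivity (uniform_matroid r E) S"
proof -
  let ?U = "uniform_matroid r E"
  let ?s = "card (S \<inter> E)" and ?t = "card (E - S)"
  \<comment> \<open>The possible capped ranks: the lower end comes from contracting all of
    \<open>S\<close>, the upper end from deleting all of it.\<close>
  let ?R = "{min ?t (r - ?s)..min ?t r}"
  have "minors_off ?U S \<subseteq> (\<lambda>k. uniform_matroid k (E - S)) ` ?R"
  proof
    fix N assume "N \<in> minors_off ?U S"
    then obtain Y where Y: "Y \<subseteq> S" and N: "N = contract (delete ?U (S - Y)) Y"
      by (auto simp: minors_off_def)
    \<comment> \<open>Deleting \<open>S - Y\<close> removes no element of \<open>Y\<close>, so the
      contraction still lowers the rank by all of \<open>Y \<inter> E\<close>.\<close>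
    have "E - (S - Y) - Y = E - S" "Y \<inter> (E - (S - Y)) = Y \<inter> E" using Y by auto
    then have "N = uniform_matroid (r - card (Y \<inter> E)) (E - S)"
      unfolding N delete_uniform_matroid using E by (simp add: contract_uniform_matroid)
    then have "N = uniform_matroid (min ?t (r - card (Y \<inter> E))) (E - S)"
      using uniform_matroid_min_card[of "E - S"] E by simp
    moreover have "card (Y \<inter> E) \<le> ?s" using Y E by (intro card_mono) auto
    then have "min ?t (r - card (Y \<inter> E)) \<in> ?R" by auto
    ultimately show "N \<in> (\<lambda>k. uniform_matroid k (E - S)) ` ?R" by blast
  qed
  then have "card (minors_off ?U S) \<le> card ?R"
    by (meson surj_card_le finite_atLeastAtMost)
  also define k where "k = min ?t r - min ?t (r - ?s)"
  have "card ?R \<le> k + 1" unfolding k_def card_atLeastAtMost by linarith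
  finally have card: "card (minors_off ?U S) \<le> k + 1" .
  have split: "?s + ?t = card E"
    using card_Int_Diff[OF E, of S] by (simp add: Int_commute)
  have "(E - S) \<inter> E = E - S" by auto
  then have "connectivity ?U S = int (min r ?s) + int (min r ?t) - int r"
    using E r by (simp add: connectivity_def rank_of_uniform_matroid)
  \<comment> \<open>Here \<open>min r ?s - r\<close> is the negative of the truncated
    \<open>r - ?s\<close>, and \<open>r - ?s \<le> ?t\<close> because
    \<open>r \<le> card E = ?s + ?t\<close>, so the lower end of \<open>?R\<close> is just
    \<open>r - ?s\<close>.\<close>
  also have "\<dots> = int k" using r split unfolding k_def by auto
  finally have "connectivity ?U S = int k" .
  moreover have "k + 1 \<le> 2 ^ k" using less_exp[of k] by (metis Suc_eq_plus1 Suc_leI)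
  then have "card (minors_off ?U S) \<le> 2 ^ k" using card by linarith
  then have "real (card (minors_off ?U S)) \<le> 2 ^ k"
    by (metis of_nat_le_iff of_nat_numeral of_nat_power)
  ultimately show ?thesis by simp
qed

section \<open>Independence, bases, connectivity and minors of direct sums\<close>

context
  fixes M1 M2 :: "'a matroid"
  assumes M1: "is_matroid M1" and M2: "is_matroid M2"
    and disj: "ground M1 \<inter> ground M2 = {}"
begin

private lemmas D1 = is_matroidD[OF M1] and D2 = is_matroidD[OF M2]

lemma ground_direct_sum: "ground (direct_sum M1 M2) = ground M1 \<union> ground M2"
  by (simp add: direct_sum_def)

text \<open>Disjointness of the ground sets forces the two pieces of \<open>I\<close> to be its
  traces, which removes the existential from the definition.\<close>

lemma indeps_direct_sum_iff:
  "I \<in> indeps (direct_sum M1 M2) \<longleftrightarrow>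
     I \<subseteq> ground M1 \<union> ground M2 \<and> I \<inter> ground M1 \<in> indeps M1 \<and> I \<inter> ground M2 \<in> indeps M2"
proof
  assume "I \<in> indeps (direct_sum M1 M2)"
  then obtain I1 I2 where I: "I = I1 \<union> I2" "I1 \<in> indeps M1" "I2 \<in> indeps M2"
    by (auto simp: direct_sum_def)
  then have "I1 \<subseteq> ground M1" "I2 \<subseteq> ground M2" using D1(2) D2(2) by auto
  moreover from this have "I \<inter> ground M1 = I1" "I \<inter> ground M2 = I2" using I(1) disj by auto
  ultimately show "I \<subseteq> ground M1 \<union> ground M2 \<and> I \<inter> ground M1 \<in> indeps M1 \<and>
      I \<inter> ground M2 \<in> indeps M2"
    using I by auto
next
  assume "I \<subseteq> ground M1 \<union> ground M2 \<and> I \<inter> ground M1 \<in> indeps M1 \<and> I \<inter> ground M2 \<in> indeps M2"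
  then show "I \<in> indeps (direct_sum M1 M2)"
    by (intro direct_sum_indepsI[of I "I \<inter> ground M1" "I \<inter> ground M2"]) auto
qed

lemma Un_indeps_direct_sum_iff:
  assumes "I1 \<subseteq> ground M1" "I2 \<subseteq> ground M2"
  shows "I1 \<union> I2 \<in> indeps (direct_sum M1 M2) \<longleftrightarrow> I1 \<in> indeps M1 \<and> I2 \<in> indeps M2"
proof -
  have "(I1 \<union> I2) \<inter> ground M1 = I1" "(I1 \<union> I2) \<inter> ground M2 = I2" using assms disj by auto
  then show ?thesis using assms by (auto simp: indeps_direct_sum_iff)
qed

text \<open>Maximality can be tested one summand at a time: enlarge one piece while keeping the
  other fixed, and cancel the fixed piece by disjointness. Conversely, an independent extension of
  the union has traces extending each basis.\<close>

lemma is_basis_of_direct_sum_iff: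
  assumes B1: "B1 \<subseteq> ground M1" and B2: "B2 \<subseteq> ground M2"
  shows "is_basis_of (direct_sum M1 M2) Y (B1 \<union> B2) \<longleftrightarrow> is_basis_of M1 Y B1 \<and> is_basis_of M2 Y B2"
proof
  assume B: "is_basis_of (direct_sum M1 M2) Y (B1 \<union> B2)"
  then have indep: "B1 \<in> indeps M1" "B2 \<in> indeps M2" and sub: "B1 \<subseteq> Y" "B2 \<subseteq> Y"
    using Un_indeps_direct_sum_iff[OF assms] by (auto simp: is_basis_of_def)
  have max: "I1 \<union> I2 = B1 \<union> B2"
    if "I1 \<in> indeps M1" "I2 \<in> indeps M2" "B1 \<subseteq> I1" "B2 \<subseteq> I2" "I1 \<subseteq> Y" "I2 \<subseteq> Y" for I1 I2
  proof -
    have "I1 \<union> I2 \<in> indeps (direct_sum M1 M2)" using that(1,2) by (blast intro: direct_sum_indepsI)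
    moreover have "B1 \<union> B2 \<subseteq> I1 \<union> I2" "I1 \<union> I2 \<subseteq> Y" using that by auto
    ultimately show ?thesis using B unfolding is_basis_of_def by blast
  qed
  have "I = B1" if "I \<in> indeps M1" "B1 \<subseteq> I" "I \<subseteq> Y" for I
  proof -
    have "I \<union> B2 = B1 \<union> B2" using max that indep(2) sub(2) by blast
    moreover have "I \<subseteq> ground M1" using that D1(2) by auto
    ultimately show ?thesis using B1 B2 disj by blast
  qed
  moreover have "I = B2" if "I \<in> indeps M2" "B2 \<subseteq> I" "I \<subseteq> Y" for I
  proof -
    have "B1 \<union> I = B1 \<union> B2" using max that indep(1) sub(1) by blast
    moreover have "I \<subseteq> ground M2" using that D2(2) by auto
    ultimately show ?thesis using B1 B2 disj by blast
  qed
  ultimately show "is_basis_of M1 Y B1 \<and> is_basis_of M2 Y B2"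
    using indep sub unfolding is_basis_of_def by blast
next
  assume B: "is_basis_of M1 Y B1 \<and> is_basis_of M2 Y B2"
  have "I = B1 \<union> B2"
    if I: "I \<in> indeps (direct_sum M1 M2)" and sub: "B1 \<union> B2 \<subseteq> I" "I \<subseteq> Y" for I
  proof -
    have indep: "I \<inter> ground M1 \<in> indeps M1" "I \<inter> ground M2 \<in> indeps M2"
      and I_sub: "I \<subseteq> ground M1 \<union> ground M2"
      using I by (simp_all add: indeps_direct_sum_iff)
    have "B1 \<subseteq> I \<inter> ground M1" "I \<inter> ground M1 \<subseteq> Y" "B2 \<subseteq> I \<inter> ground M2" "I \<inter> ground M2 \<subseteq> Y"
      using sub B1 B2 by auto
    then have "I \<inter> ground M1 = B1" "I \<inter> ground M2 = B2"
      using B indep by (simp_all add: is_basis_of_def)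
    then show ?thesis using I_sub by blast
  qed
  moreover have "B1 \<union> B2 \<in> indeps (direct_sum M1 M2)" "B1 \<union> B2 \<subseteq> Y"
    using B Un_indeps_direct_sum_iff[OF assms] by (auto simp: is_basis_of_def)
  ultimately show "is_basis_of (direct_sum M1 M2) Y (B1 \<union> B2)"
    unfolding is_basis_of_def by blast
qed

lemma rank_of_direct_sum:
  "rank_of (direct_sum M1 M2) X = rank_of M1 X + rank_of M2 X"
proof -
  obtain B1 B2 where B: "is_basis_of M1 X B1" "is_basis_of M2 X B2"
    using is_basis_of_exists M1 M2 by blast
  then have indep: "B1 \<in> indeps M1" "B2 \<in> indeps M2" by (auto simp: is_basis_of_def)
  then have sub: "B1 \<subseteq> ground M1" "B2 \<subseteq> ground M2" using D1(2) D2(2) by auto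
  have "rank_of (direct_sum M1 M2) X = card (B1 \<union> B2)"
    using card_eq_rank_of[OF is_matroid_direct_sum[OF M1 M2 disj]]
      is_basis_of_direct_sum_iff[OF sub] B by metis
  also have "\<dots> = card B1 + card B2"
    using sub disj D1(6) D2(6) indep by (intro card_Un_disjoint) auto
  finally show ?thesis using card_eq_rank_of M1 M2 B by metis
qed

lemma connectivity_direct_sum:
  "connectivity (direct_sum M1 M2) X = connectivity M1 X + connectivity M2 X"
proof -
  let ?E = "ground M1 \<union> ground M2"
  \<comment> \<open>Complements are taken in the whole ground set; intersecting with a summand's
    ground set gives the complement used in its own connectivity.\<close>
  have "(?E - X) \<inter> ground M1 = ground M1 - X" "(?E - X) \<inter> ground M2 = ground M2 - X"
    "?E \<inter> ground M1 = ground M1" "?E \<inter> ground M2 = ground M2" by auto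
  then have "rank_of M1 (?E - X) = rank_of M1 (ground M1 - X)"
    "rank_of M2 (?E - X) = rank_of M2 (ground M2 - X)"
    "rank_of M1 ?E = rank_of M1 (ground M1)" "rank_of M2 ?E = rank_of M2 (ground M2)"
    using rank_of_Int_ground M1 M2 by metis+
  then show ?thesis by (simp add: connectivity_def rank_of_direct_sum ground_direct_sum)
qed

lemma delete_direct_sum:
  "delete (direct_sum M1 M2) X = direct_sum (delete M1 X) (delete M2 X)"
  by (auto simp: delete_def direct_sum_def)

text \<open>A basis of \<open>Y\<close> in the sum splits into bases in the summands, and such bases
  can be glued; the same splitting applies to the sets \<open>I \<union> B\<close>.\<close>

lemma contract_direct_sum:
  "contract (direct_sum M1 M2) Y = direct_sum (contract M1 Y) (contract M2 Y)"
proof -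
  have "indeps (contract (direct_sum M1 M2) Y) = indeps (direct_sum (contract M1 Y) (contract M2 Y))"
  proof (intro set_eqI iffI)
    fix I assume "I \<in> indeps (contract (direct_sum M1 M2) Y)"
    then obtain B where I: "I \<subseteq> ground M1 \<union> ground M2 - Y"
      and B: "is_basis_of (direct_sum M1 M2) Y B" and IB: "I \<union> B \<in> indeps (direct_sum M1 M2)"
      by (auto simp: contract_def ground_direct_sum)
    \<comment> \<open>Independence of \<open>I \<union> B\<close> places \<open>B\<close> inside the
      union of the ground sets.\<close>
    have B_split: "B = (B \<inter> ground M1) \<union> (B \<inter> ground M2)"
      using IB by (auto simp: indeps_direct_sum_iff)
    then have bases: "is_basis_of M1 Y (B \<inter> ground M1)" "is_basis_of M2 Y (B \<inter> ground M2)"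
      using B is_basis_of_direct_sum_iff[of "B \<inter> ground M1" "B \<inter> ground M2" Y] by auto
    have "I \<inter> ground M1 \<union> B \<inter> ground M1 \<in> indeps M1" "I \<inter> ground M2 \<union> B \<inter> ground M2 \<in> indeps M2"
      using IB by (auto simp: indeps_direct_sum_iff Int_Un_distrib2)
    then have "I \<inter> ground M1 \<in> indeps (contract M1 Y)" "I \<inter> ground M2 \<in> indeps (contract M2 Y)"
      using bases I by (auto simp: contract_def)
    moreover have "I = (I \<inter> ground M1) \<union> (I \<inter> ground M2)" using I by auto
    ultimately show "I \<in> indeps (direct_sum (contract M1 Y) (contract M2 Y))"
      by (metis direct_sum_indepsI)
  next
    fix I assume "I \<in> indeps (direct_sum (contract M1 Y) (contract M2 Y))"
    then obtain I1 I2 B1 B2 where I: "I = I1 \<union> I2"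
      and I1: "I1 \<subseteq> ground M1 - Y" "is_basis_of M1 Y B1" "I1 \<union> B1 \<in> indeps M1"
      and I2: "I2 \<subseteq> ground M2 - Y" "is_basis_of M2 Y B2" "I2 \<union> B2 \<in> indeps M2"
      by (auto simp: direct_sum_def contract_def)
    have "B1 \<subseteq> ground M1" "B2 \<subseteq> ground M2" using I1(3) I2(3) D1(2) D2(2) by auto
    then have "is_basis_of (direct_sum M1 M2) Y (B1 \<union> B2)"
      using is_basis_of_direct_sum_iff I1(2) I2(2) by blast
    moreover have "I \<union> (B1 \<union> B2) \<in> indeps (direct_sum M1 M2)"
      using I1(3) I2(3) unfolding I by (intro direct_sum_indepsI[of _ "I1 \<union> B1" "I2 \<union> B2"]) auto
    moreover have "I \<subseteq> ground M1 \<union> ground M2 - Y" using I I1(1) I2(1) by auto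
    ultimately show "I \<in> indeps (contract (direct_sum M1 M2) Y)"
      by (auto simp: contract_def ground_direct_sum)
  qed
  then show ?thesis
    by (intro matroid.expand conjI) (auto simp: contract_def direct_sum_def)
qed

end

text \<open>The same \<open>Y\<close> serves both summands, so each minor of the sum arises from a
  pair of minors. This bounds the count by a product.\<close>

lemma minors_off_direct_sum_subset:
  assumes "is_matroid M1" "is_matroid M2" "ground M1 \<inter> ground M2 = {}"
  shows "minors_off (direct_sum M1 M2) S
    \<subseteq> (\<lambda>(N1, N2). direct_sum N1 N2) ` (minors_off M1 S \<times> minors_off M2 S)"
proof
  fix N assume "N \<in> minors_off (direct_sum M1 M2) S"
  then obtain Y where Y: "Y \<subseteq> S" and N: "N = contract (delete (direct_sum M1 M2) (S - Y)) Y"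
    by (auto simp: minors_off_def)
  have "ground (delete M1 (S - Y)) \<inter> ground (delete M2 (S - Y)) = {}"
    using assms(3) by (auto simp: delete_def)
  then have "N = direct_sum (contract (delete M1 (S - Y)) Y) (contract (delete M2 (S - Y)) Y)"
    unfolding N using assms
    by (simp add: delete_direct_sum contract_direct_sum is_matroid_delete)
  then show "N \<in> (\<lambda>(N1, N2). direct_sum N1 N2) ` (minors_off M1 S \<times> minors_off M2 S)"
    using Y by (auto simp: minors_off_def)
qed

section \<open>The bound for partition matroids\<close>

text \<open>Multiplicativity of the counting bound matches additivity of the exponent. Since
  \<open>S\<close> may leave the ground set, the same \<open>S\<close> passes to both summands in
  the induction; its finiteness makes the families of minors finite.\<close>

lemma card_minors_off_partition_matroid:
  assumes "partition_matroid M" "finite S"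
  shows "real (card (minors_off M S)) \<le> 2 powi connectivity M S"
  using assms
proof (induction rule: partition_matroid.induct)
  case (uniform E r)
  from uniform.hyps show ?case by (rule card_minors_off_uniform_matroid)
next
  case (sum M1 M2)
  then have M: "is_matroid M1" "is_matroid M2" by (simp_all add: partition_matroid_is_matroid)
  have "card (minors_off (direct_sum M1 M2) S) \<le> card (minors_off M1 S \<times> minors_off M2 S)"
    using sum.prems
    by (intro surj_card_le[OF _ minors_off_direct_sum_subset[OF M sum.hyps(3)]]
        finite_cartesian_product finite_minors_off)
  then have "real (card (minors_off (direct_sum M1 M2) S))
      \<le> real (card (minors_off M1 S)) * real (card (minors_off M2 S))"
    by (metis card_cartesian_product of_nat_le_iff of_nat_mult)
  also have "\<dots> \<le> 2 powi connectivity M1 S * 2 powi connectivity M2 S"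
    using sum by (intro mult_mono) auto
  also have "\<dots> = 2 powi connectivity (direct_sum M1 M2) S"
    using M sum.hyps(3) by (simp add: connectivity_direct_sum power_int_add)
  finally show ?case .
qed

theorem theorem4p5:
  fixes M :: "'a matroid" and e :: "nat \<Rightarrow> 'a" and n i :: nat
  assumes "partition_matroid M"
    and "bij_betw e {1..n} (ground M)"
    and "i \<le> n"
  shows "real (card (minors_off M (e ` {1..i}))) \<le> 2 powi connectivity M (e ` {1..i})"
  using assms(1) by (rule card_minors_off_partition_matroid) simp

end
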